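(* For every positive integer $n$, $$r_6(\mathbb{Z}_6^n)\leq 2^{n+1}\sqrt{3^n\, r_3(\mathbb{Z}_3^n)}.$$
   Context: Here $\mathbb{Z}_m^n := (\mathbb{Z}/m\mathbb{Z})^n$. A $k$-term arithmetic progression is a sequence $a, a+d, a+2d,\dots,a+(k-1)d$ with $a,d\in\mathbb{Z}_m^n$. $r_k(\mathbb{Z}_m^n)$ denotes the maximal size of a set $A\subseteq\mathbb{Z}_m^n$ containing no $k$ distinct elements in arithmetic progression, i.e. no $k$-term arithmetic progression whose $k$ terms are pairwise distinct. *)

theory Defs
  imports Complex_Main "HOL-Algebra.Elementary_Groups" "HOL-Algebra.Product_Groups"
begin

text \<open>\<open>(\<int>/m\<int>)\<^sup>n\<close>, as tuples indexed by \<open>{..<n}\<close>. HOL-Algebra groups are written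
  multiplicatively: \<open>a \<otimes> d [^] i\<close> below is \<open>a + i d\<close>.\<close>

definition zmod_power :: "nat \<Rightarrow> nat \<Rightarrow> (nat \<Rightarrow> int) monoid"
  where "zmod_power m n = product_group {..<n} (\<lambda>_. integer_mod_group m)"

definition ap_term :: "('a, 'b) monoid_scheme \<Rightarrow> 'a \<Rightarrow> 'a \<Rightarrow> nat \<Rightarrow> 'a"
  where "ap_term G a d i = a \<otimes>\<^bsub>G\<^esub> (d [^]\<^bsub>G\<^esub> i)"

definition contains_proper_ap :: "nat \<Rightarrow> ('a, 'b) monoid_scheme \<Rightarrow> 'a set \<Rightarrow> bool"
  where "contains_proper_ap k G A \<longleftrightarrow>
    (\<exists>a \<in> carrier G. \<exists>d \<in> carrier G.
      (\<forall>i<k. ap_term G a d i \<in> A) \<and> inj_on (ap_term G a d) {..<k})"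

text \<open>The extremal number \<open>r\<^sub>k(G)\<close> of a finite group. For \<open>k \<ge> 1\<close> the maximum is over
  a nonempty finite set; otherwise \<open>Max\<close> need not be meaningful.\<close>

definition ap_free_max :: "nat \<Rightarrow> ('a, 'b) monoid_scheme \<Rightarrow> nat"
  where "ap_free_max k G =
    Max {card A | A. A \<subseteq> carrier G \<and> \<not> contains_proper_ap k G A}"

lemma finite_carrier_zmod_power:
  assumes "m > 0"
  shows "finite (carrier (zmod_power m n))"
  using assms by (auto simp: zmod_power_def carrier_integer_mod_group intro!: finite_PiE)

lemma ap_free_max_attained:
  assumes "finite (carrier G)" and "k > 0"
  shows "\<exists>A. A \<subseteq> carrier G \<and> \<not> contains_proper_ap k G A \<and> card A = ap_free_max k G"
    and "\<lbrakk>B \<subseteq> carrier G; \<not> contains_proper_ap k G B\<rbrakk> \<Longrightarrow> card B \<le> ap_free_max k G"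
proof -
  let ?S = "{card A | A. A \<subseteq> carrier G \<and> \<not> contains_proper_ap k G A}"
  have "?S \<subseteq> card ` Pow (carrier G)"
    by auto
  then have fin: "finite ?S"
    using assms(1) by (meson finite_Pow_iff finite_imageI finite_subset)
  have "\<not> contains_proper_ap k G {}"
    using assms(2) by (auto simp: contains_proper_ap_def)
  then have "?S \<noteq> {}"
    by blast
  from Max_in[OF fin this]
  show "\<exists>A. A \<subseteq> carrier G \<and> \<not> contains_proper_ap k G A \<and> card A = ap_free_max k G"
    unfolding ap_free_max_def by auto
  show "card B \<le> ap_free_max k G"
    if "B \<subseteq> carrier G" "\<not> contains_proper_ap k G B"
    unfolding ap_free_max_def using that by (intro Max_ge[OF fin]) blast
qed

end

theory Submission
  imports Defs "HOL-Analysis.Convex"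
begin

text \<open>By the Chinese remainder theorem \<open>\<int>\<^sub>6\<^sup>n \<cong> \<int>\<^sub>2\<^sup>n \<times> \<int>\<^sub>3\<^sup>n\<close>, and a proper 6-term progression is exactly a
  product \<open>{x, y} \<times> L\<close> of a two-element set and a line of \<open>\<int>\<^sub>3\<^sup>n\<close>. So if \<open>A\<close> is free of proper
  6-term progressions, any two of its fibres over distinct points of \<open>\<int>\<^sub>2\<^sup>n\<close> have a progression-free
  intersection, of size at most \<open>r = r\<^sub>3(\<int>\<^sub>3\<^sup>n)\<close>. Cauchy--Schwarz over \<open>\<int>\<^sub>3\<^sup>n\<close> then gives
  \<open>|A|\<^sup>2 \<le> 3\<^sup>n (|A| + 4\<^sup>n r)\<close>, and the diagonal term is harmless because
  \<open>|A| \<le> 6\<^sup>n \<le> 4\<^sup>n r\<close>, using \<open>r \<ge> 2\<^sup>n\<close> (witnessed by \<open>{0, 1}\<^sup>n\<close>).\<close>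

lemma carrier_zmod_power:
  "m > 0 \<Longrightarrow> carrier (zmod_power m n) = {..<n} \<rightarrow>\<^sub>E {0..<int m}"
  by (simp add: zmod_power_def carrier_integer_mod_group)

lemma zmod_power_coord_mod:
  assumes "x \<in> carrier (zmod_power m n)" "m > 0" "j < n"
  shows "x j mod int m = x j"
  using PiE_mem[of x "{..<n}" "\<lambda>_. {0..<int m}" j] assms by (simp add: carrier_zmod_power)

lemma card_carrier_zmod_power: "m > 0 \<Longrightarrow> card (carrier (zmod_power m n)) = m ^ n"
  by (simp add: carrier_zmod_power card_PiE)

lemma pow_product_group:
  "x [^]\<^bsub>product_group I G\<^esub> (k::nat) = (\<lambda>i\<in>I. x i [^]\<^bsub>G i\<^esub> k)"
  by (induction k) auto

lemma ap_term_zmod_power: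
  "ap_term (zmod_power m n) a d i = (\<lambda>j\<in>{..<n}. (a j + int i * d j) mod int m)"
  by (auto simp: ap_term_def zmod_power_def pow_product_group mod_add_right_eq)

lemma contains_proper_apE:
  assumes "contains_proper_ap k G A"
  obtains a d where "\<And>i. i < k \<Longrightarrow> ap_term G a d i \<in> A" "inj_on (ap_term G a d) {..<k}"
  using assms unfolding contains_proper_ap_def by blast

text \<open>Double counting: \<open>deg z\<close> is the number of sets \<open>F x\<close> through
  \<open>z\<close>. Its first moment is the total size and its second moment sums the sizes of all
  pairwise intersections, so Cauchy--Schwarz over \<open>Z\<close> relates the two.\<close>

lemma sum_card_squared_le:
  fixes F :: "'a \<Rightarrow> 'b set"
  assumes X: "finite X" and Z: "finite Z" and sub: "\<And>x. x \<in> X \<Longrightarrow> F x \<subseteq> Z"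
    and inter: "\<And>x y. \<lbrakk>x \<in> X; y \<in> X; x \<noteq> y\<rbrakk> \<Longrightarrow> card (F x \<inter> F y) \<le> r"
  shows "(\<Sum>x\<in>X. card (F x))\<^sup>2 \<le> card Z * ((\<Sum>x\<in>X. card (F x)) + (card X)\<^sup>2 * r)"
proof -
  define deg where "deg z = (\<Sum>x\<in>X. of_bool (z \<in> F x) :: nat)" for z
  have card_eq: "card B = (\<Sum>z\<in>Z. of_bool (z \<in> B))" if "B \<subseteq> Z" for B
    using that Z by (simp add: Int_absorb1)
  have S: "(\<Sum>x\<in>X. card (F x)) = (\<Sum>z\<in>Z. deg z)"
    unfolding deg_def by (subst sum.swap) (simp add: card_eq sub del: sum_of_bool_eq)
  have "(\<Sum>z\<in>Z. (deg z)\<^sup>2) = (\<Sum>z\<in>Z. \<Sum>x\<in>X. \<Sum>y\<in>X. of_bool (z \<in> F x \<inter> F y))"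
    by (simp add: deg_def power2_eq_square sum_product of_bool_conj del: sum_of_bool_eq)
  also have "\<dots> = (\<Sum>x\<in>X. \<Sum>y\<in>X. \<Sum>z\<in>Z. of_bool (z \<in> F x \<inter> F y))"
    by (subst sum.swap, rule sum.cong[OF refl], rule sum.swap)
  also have "\<dots> = (\<Sum>x\<in>X. \<Sum>y\<in>X. card (F x \<inter> F y))"
    using sub by (intro sum.cong refl card_eq[symmetric]) blast
  \<comment> \<open>The bound \<open>r\<close> is granted to diagonal pairs as well, which turns the
    pair count into the plain square of \<open>card X\<close>.\<close>
  also have "\<dots> \<le> (\<Sum>x\<in>X. \<Sum>y\<in>X. (if x = y then card (F x) else 0) + r)"
    by (intro sum_mono) (auto intro: inter)
  also have "\<dots> = (\<Sum>x\<in>X. card (F x)) + (card X)\<^sup>2 * r"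
    using X by (simp add: sum.distrib power2_eq_square)
  finally have *: "(\<Sum>z\<in>Z. (deg z)\<^sup>2) \<le> (\<Sum>x\<in>X. card (F x)) + (card X)\<^sup>2 * r" .
  have "real ((\<Sum>z\<in>Z. deg z)\<^sup>2) \<le> real ((\<Sum>z\<in>Z. (deg z)\<^sup>2) * card Z)"
    using sum_squared_le_sum_of_squares[of "\<lambda>z. real (deg z)" Z] by simp
  then have "(\<Sum>z\<in>Z. deg z)\<^sup>2 \<le> (\<Sum>z\<in>Z. (deg z)\<^sup>2) * card Z"
    by (simp only: of_nat_le_iff)
  also have "\<dots> \<le> ((\<Sum>x\<in>X. card (F x)) + (card X)\<^sup>2 * r) * card Z"
    using * by (rule mult_right_mono) simp
  finally show ?thesis
    by (simp add: S mult.commute)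
qed

text \<open>\<open>3\<close> and \<open>4\<close> are the idempotents of \<open>\<int>\<^sub>6\<close>.\<close>

definition crt :: "nat \<Rightarrow> (nat \<Rightarrow> int) \<Rightarrow> (nat \<Rightarrow> int) \<Rightarrow> nat \<Rightarrow> int"
  where "crt n x z = (\<lambda>j\<in>{..<n}. (3 * x j + 4 * z j) mod 6)"

lemma crt_mod:
  fixes u w :: int
  shows "(3 * u + 4 * w) mod 6 mod 2 = u mod 2" and "(3 * u + 4 * w) mod 6 mod 3 = w mod 3"
  \<comment> \<open>\<open>3 * u + 4 * w\<close> is \<open>u\<close> plus a multiple of 2, and also
    \<open>w\<close> plus a multiple of 3.\<close>
  using mod_mult_self2[of u 2 "u + 2 * w"] mod_mult_self2[of w 3 "u + w"]
  by (simp_all add: mod_mod_cancel)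

text \<open>Both 3 * 2 and 4 * 3 vanish modulo 6, so \<open>crt\<close> depends only on the residues
  of its arguments and these may be left unreduced.\<close>

lemma crt_mod_arguments:
  fixes c :: int
  shows "3 * (c mod 2) mod 6 = 3 * c mod 6" and "4 * (c mod 3) mod 6 = 4 * c mod 6"
  by (simp_all add: mult_mod_right mod_mod_cancel)

lemma crt_in_carrier: "crt n x z \<in> carrier (zmod_power 6 n)"
  by (auto simp: crt_def carrier_zmod_power)

lemma crt_inject:
  assumes "x \<in> carrier (zmod_power 2 n)" "x' \<in> carrier (zmod_power 2 n)"
    and "z \<in> carrier (zmod_power 3 n)" "z' \<in> carrier (zmod_power 3 n)"
    and eq: "crt n x z = crt n x' z'"
  shows "x = x' \<and> z = z'"
proof -
  have *: "x j = x' j \<and> z j = z' j" if "j < n" for j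
  proof -
    have "(3 * x j + 4 * z j) mod 6 = (3 * x' j + 4 * z' j) mod 6"
      using fun_cong[OF eq, of j] that by (simp add: crt_def)
    then have "x j mod 2 = x' j mod 2" "z j mod 3 = z' j mod 3"
      by (metis crt_mod)+
    then show ?thesis
      using zmod_power_coord_mod[OF assms(1) _ that] zmod_power_coord_mod[OF assms(2) _ that]
        zmod_power_coord_mod[OF assms(3) _ that] zmod_power_coord_mod[OF assms(4) _ that] by simp
  qed
  have "x = x'"
    using assms(1,2) *
    by (intro PiE_ext[of x "{..<n}" "\<lambda>_. {0..<2}" x']) (simp_all add: carrier_zmod_power)
  moreover have "z = z'"
    using assms(3,4) *
    by (intro PiE_ext[of z "{..<n}" "\<lambda>_. {0..<3}" z']) (simp_all add: carrier_zmod_power)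
  ultimately show ?thesis
    by blast
qed

lemma crt_surject:
  assumes "v \<in> carrier (zmod_power 6 n)"
  obtains x z where "x \<in> carrier (zmod_power 2 n)" "z \<in> carrier (zmod_power 3 n)" "v = crt n x z"
proof
  let ?red = "\<lambda>m. \<lambda>j\<in>{..<n}. v j mod int m"
  show "?red 2 \<in> carrier (zmod_power 2 n)" "?red 3 \<in> carrier (zmod_power 3 n)"
    by (auto simp: carrier_zmod_power)
  have "v j = (3 * (v j mod 2) + 4 * (v j mod 3)) mod 6" if "j < n" for j
  proof -
    have "(3 * (v j mod 2) + 4 * (v j mod 3)) mod 6 = (3 * v j + 4 * v j) mod 6"
      by (rule mod_add_cong) (rule crt_mod_arguments)+
    also have "\<dots> = v j mod 6"
      \<comment> \<open>The two idempotents sum to 7, which is 1 modulo 6.\<close>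
      using mod_mult_self2[of "v j" 6 "v j"] by simp
    also have "\<dots> = v j"
      using zmod_power_coord_mod[OF assms _ that] by simp
    finally show ?thesis ..
  qed
  moreover have "v \<in> extensional {..<n}"
    using assms by (auto simp: carrier_zmod_power PiE_def)
  ultimately show "v = crt n (?red 2) (?red 3)"
    by (auto simp: crt_def fun_eq_iff extensional_def)
qed

text \<open>In characteristic 2 the step from \<open>x\<close> to \<open>y\<close> is
  \<open>x + y\<close>, so the first component alternates with the parity of \<open>i\<close>. The
  second component follows the progression of \<open>a\<close> and \<open>d\<close> with period
  3.\<close>

lemma crt_ap_term:
  assumes "i < 6"
  shows "ap_term (zmod_power 6 n) (crt n x a) (crt n (\<lambda>j. x j + y j) d) i
    = crt n (if even i then x else y) (ap_term (zmod_power 3 n) a d (i mod 3))"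
proof -
  have "((3 * u + 4 * b) mod 6 + int i * ((3 * (u + w) + 4 * e) mod 6)) mod 6
    = (3 * (if even i then u else w) + 4 * ((b + int (i mod 3) * e) mod 3)) mod 6"
    (is "?lhs = ?rhs") for u w b e :: int
  proof -
    have "?lhs = (3 * u + 4 * b + int i * (3 * (u + w) + 4 * e)) mod 6"
      by (rule mod_add_cong[OF mod_mod_trivial mod_mult_right_eq])
    also have "\<dots> = (3 * (if even i then u else w) + 4 * (b + int (i mod 3) * e)) mod 6"
    proof -
      consider "i = 0" | "i = 1" | "i = 2" | "i = 3" | "i = 4" | "i = 5"
        using assms by linarith
      then show ?thesis
        by cases (simp_all add: mod_eq_dvd_iff algebra_simps)
    qed
    also have "\<dots> = ?rhs"
      by (rule mod_add_cong[OF refl crt_mod_arguments(2)[symmetric]])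
    finally show ?thesis .
  qed
  then show ?thesis
    by (auto simp: ap_term_zmod_power crt_def fun_eq_iff)
qed

text \<open>Fibres are recorded in the coordinates of \<int>_3^n, so that those over different
  points can be intersected.\<close>

definition fibre :: "nat \<Rightarrow> (nat \<Rightarrow> int) set \<Rightarrow> (nat \<Rightarrow> int) \<Rightarrow> (nat \<Rightarrow> int) set"
  where "fibre n A x = {z \<in> carrier (zmod_power 3 n). crt n x z \<in> A}"

text \<open>A progression common to both fibres, alternated between \<open>x\<close> and
  \<open>y\<close>, would lift to a proper 6-term progression in \<open>A\<close>.\<close>

lemma not_contains_proper_ap_fibre_Int:
  assumes free: "\<not> contains_proper_ap 6 (zmod_power 6 n) A"
    and x: "x \<in> carrier (zmod_power 2 n)" and y: "y \<in> carrier (zmod_power 2 n)" and "x \<noteq> y"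
  shows "\<not> contains_proper_ap 3 (zmod_power 3 n) (fibre n A x \<inter> fibre n A y)"
proof
  assume "contains_proper_ap 3 (zmod_power 3 n) (fibre n A x \<inter> fibre n A y)"
  then obtain a d where
    mem: "\<And>i. i < 3 \<Longrightarrow> ap_term (zmod_power 3 n) a d i \<in> fibre n A x \<inter> fibre n A y"
    and inj: "inj_on (ap_term (zmod_power 3 n) a d) {..<3}"
    by (rule contains_proper_apE) (rule that)
  let ?t = "ap_term (zmod_power 6 n) (crt n x a) (crt n (\<lambda>j. x j + y j) d)"
  have "?t i \<in> A" if "i < 6" for i
    using mem[of "i mod 3"] that by (auto simp: crt_ap_term fibre_def)
  moreover have "inj_on ?t {..<6}"
  proof (rule inj_onI)
    fix i k :: nat
    assume ik: "i \<in> {..<6}" "k \<in> {..<6}" and "?t i = ?t k"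
    then have eq: "crt n (if even i then x else y) (ap_term (zmod_power 3 n) a d (i mod 3))
      = crt n (if even k then x else y) (ap_term (zmod_power 3 n) a d (k mod 3))"
      by (simp add: crt_ap_term)
    have "ap_term (zmod_power 3 n) a d (l mod 3) \<in> carrier (zmod_power 3 n)" for l
      by (auto simp: ap_term_zmod_power carrier_zmod_power)
    from crt_inject[OF _ _ this this eq]
    have "(if even i then x else y) = (if even k then x else y)"
      and "ap_term (zmod_power 3 n) a d (i mod 3) = ap_term (zmod_power 3 n) a d (k mod 3)"
      using x y by (auto split: if_splits)
    then have "even i = even k" "i mod 3 = k mod 3"
      using \<open>x \<noteq> y\<close> inj by (auto split: if_splits simp: inj_on_def)
    \<comment> \<open>Below 6 an index is determined by its parity and its residue modulo 3; the
      finite check stands in for the Chinese remainder theorem.\<close>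
    moreover have "i \<in> {0, 1, 2, 3, 4, 5}" "k \<in> {0, 1, 2, 3, 4, 5}"
      using ik by auto
    ultimately show "i = k"
      by auto
  qed
  ultimately show False
    using free crt_in_carrier unfolding contains_proper_ap_def by blast
qed

text \<open>A step that is nonzero modulo 3 in some coordinate makes the three terms run through all
  residues there, including 2. A progression inside \<open>{0, 1}\<close> in every coordinate is
  therefore constant.\<close>

lemma ap_free_max_3_zmod_power_3_ge: "2 ^ n \<le> ap_free_max 3 (zmod_power 3 n)"
proof -
  let ?B = "{..<n} \<rightarrow>\<^sub>E {0, 1 :: int}"
  have "\<not> contains_proper_ap 3 (zmod_power 3 n) ?B"
  proof
    assume "contains_proper_ap 3 (zmod_power 3 n) ?B"
    then obtain a d where mem: "\<And>i. i < 3 \<Longrightarrow> ap_term (zmod_power 3 n) a d i \<in> ?B"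
      and inj: "inj_on (ap_term (zmod_power 3 n) a d) {..<3}"
      by (rule contains_proper_apE) (rule that)
    have "(a j + 0 * d j) mod 3 = (a j + 1 * d j) mod 3" if "j < n" for j
    proof -
      have "(a j + int i * d j) mod 3 \<in> {0, 1}" if "i < 3" for i
        using PiE_mem[OF mem[OF that], of j] \<open>j < n\<close> by (simp add: ap_term_zmod_power)
      from this[of 0] this[of 1] this[of 2] have "a j mod 3 \<in> {0, 1}"
        "(a j + d j) mod 3 \<in> {0, 1}" "(a j + 2 * d j) mod 3 \<in> {0, 1}"
        by simp_all
      moreover have "(a j mod 3 + d j mod 3) mod 3 = (a j + d j) mod 3"
        by (rule mod_add_eq)
      moreover have "(a j mod 3 + 2 * (d j mod 3)) mod 3 = (a j + 2 * d j) mod 3"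
        by (rule mod_add_cong[OF mod_mod_trivial mod_mult_right_eq])
      moreover have "d j mod 3 \<in> {0..<3}"
        by simp
      then have "d j mod 3 \<in> {0, 1, 2}"
        by auto
      ultimately show ?thesis
        by (elim insertE emptyE) simp_all
    qed
    then have "ap_term (zmod_power 3 n) a d 0 = ap_term (zmod_power 3 n) a d 1"
      by (auto simp: ap_term_zmod_power fun_eq_iff)
    with inj_onD[OF inj, of 0 1] show False
      by simp
  qed
  moreover have "?B \<subseteq> carrier (zmod_power 3 n)"
    unfolding carrier_zmod_power[OF zero_less_numeral] by (rule PiE_mono) simp
  ultimately have "card ?B \<le> ap_free_max 3 (zmod_power 3 n)"
    by (intro ap_free_max_attained(2)) (auto simp: finite_carrier_zmod_power)
  then show ?thesis
    by (simp add: card_PiE numeral_2_eq_2)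
qed

theorem theorem1p4:
  fixes n :: nat
  assumes "n > 0"
  shows "real (ap_free_max 6 (zmod_power 6 n))
    \<le> 2 ^ (n + 1) * sqrt (3 ^ n * real (ap_free_max 3 (zmod_power 3 n)))"
proof -
  define r where "r = ap_free_max 3 (zmod_power 3 n)"
  let ?X = "carrier (zmod_power 2 n)" and ?Z = "carrier (zmod_power 3 n)"
  have fin: "finite ?X" "finite ?Z"
    by (simp_all add: finite_carrier_zmod_power)
  obtain A where A: "A \<subseteq> carrier (zmod_power 6 n)"
    and free: "\<not> contains_proper_ap 6 (zmod_power 6 n) A"
    and card_A: "card A = ap_free_max 6 (zmod_power 6 n)"
    using ap_free_max_attained(1)[of "zmod_power 6 n" 6] finite_carrier_zmod_power[of 6 n] by auto
  define S where "S = (\<Sum>x\<in>?X. card (fibre n A x))"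
  have sub: "fibre n A x \<subseteq> ?Z" for x
    by (auto simp: fibre_def)
  \<comment> \<open>Only an upper bound on \<open>card A\<close> is wanted, so covering
    \<open>A\<close> by the disjoint union of its fibres suffices.\<close>
  have "A \<subseteq> (\<lambda>(x, z). crt n x z) ` (SIGMA x:?X. fibre n A x)"
  proof
    fix v assume "v \<in> A"
    with A obtain x z where "x \<in> ?X" "z \<in> ?Z" "v = crt n x z"
      by (blast elim: crt_surject)
    with \<open>v \<in> A\<close> show "v \<in> (\<lambda>(x, z). crt n x z) ` (SIGMA x:?X. fibre n A x)"
      by (auto simp: fibre_def)
  qed
  then have "card A \<le> card (SIGMA x:?X. fibre n A x)"
    using fin finite_subset[OF sub fin(2)] by (intro surj_card_le) auto
  also have "\<dots> = S"
    using fin finite_subset[OF sub fin(2)] by (simp add: S_def)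
  finally have card_A_le: "card A \<le> S" .
  have "S \<le> (\<Sum>x\<in>?X. card ?Z)"
    unfolding S_def using fin sub by (intro sum_mono card_mono)
  also have "\<dots> = 2 ^ n * 3 ^ n"
    by (simp add: card_carrier_zmod_power)
  \<comment> \<open>Weakening \<open>3 ^ n\<close> to \<open>4 ^ n\<close> produces the shape of the
    off-diagonal term and leaves a factor \<open>2 ^ n\<close>, which is at most
    \<open>r\<close>.\<close>
  also have "\<dots> \<le> 2 ^ n * (4 ^ n :: nat)"
    by (simp add: power_mono)
  also have "\<dots> \<le> r * 4 ^ n"
    using ap_free_max_3_zmod_power_3_ge[of n] by (simp add: r_def)
  finally have S_le: "S \<le> r * 4 ^ n" .
  have "S\<^sup>2 \<le> card ?Z * (S + (card ?X)\<^sup>2 * r)"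
    unfolding S_def
  proof (rule sum_card_squared_le[OF fin sub])
    fix x y assume "x \<in> ?X" "y \<in> ?X" "x \<noteq> y"
    then have "\<not> contains_proper_ap 3 (zmod_power 3 n) (fibre n A x \<inter> fibre n A y)"
      by (rule not_contains_proper_ap_fibre_Int[OF free])
    then show "card (fibre n A x \<inter> fibre n A y) \<le> r"
      unfolding r_def using fin(2) sub by (intro ap_free_max_attained(2)) (simp_all add: le_infI1)
  qed
  also have "\<dots> = 3 ^ n * (S + (2 ^ n)\<^sup>2 * r)"
    by (simp add: card_carrier_zmod_power)
  \<comment> \<open>The sum is at most \<open>2 * 4 ^ n * r\<close>; the larger constant 4 makes
    \<open>4 * 4 ^ n\<close> the square of \<open>2 ^ (n + 1)\<close>.\<close>
  also have "\<dots> \<le> 3 ^ n * (4 * 4 ^ n * r)"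
  proof (rule mult_left_mono)
    have "(2 ^ n)\<^sup>2 = (4 ^ n :: nat)"
      by (simp add: power2_eq_square flip: power_mult_distrib)
    with S_le show "S + (2 ^ n)\<^sup>2 * r \<le> 4 * 4 ^ n * r"
      by (simp add: mult.commute)
  qed simp
  finally have "real (S\<^sup>2) \<le> real (3 ^ n * (4 * 4 ^ n * r))"
    by (simp only: of_nat_le_iff)
  also have "\<dots> = (2 ^ (n + 1))\<^sup>2 * (3 ^ n * real r)"
    by (simp add: power2_eq_square flip: power_mult_distrib)
  also have "\<dots> = (2 ^ (n + 1) * sqrt (3 ^ n * real r))\<^sup>2"
    by (simp only: power_mult_distrib real_sqrt_pow2 zero_le_mult_iff zero_le_power zero_le_numeral
        of_nat_0_le_iff simp_thms)
  finally have "(real S)\<^sup>2 \<le> (2 ^ (n + 1) * sqrt (3 ^ n * real r))\<^sup>2"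
    by (simp only: of_nat_power)
  then have "real S \<le> 2 ^ (n + 1) * sqrt (3 ^ n * real r)"
    by (rule power2_le_imp_le) simp
  with card_A_le show ?thesis
    by (simp add: card_A r_def)
qed

end
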